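(* Let $\omega\in\mathbb{R}$. There exists $\tilde K>1$, depending on $\omega$, such that the following holds. Let $\alpha\in\mathbb{C}$ with $\operatorname{Re}(\alpha)>\tilde K$ and $|\alpha|\le\operatorname{Re}(\alpha)^2$. Let $$E=\Big\{w\in C^1(\mathbb{R};\mathbb{C}):\ w(0)=w'(0)=0,\ w\text{ even},\ \|w\|_{L^\infty}+\||x|^{-1}w'\|_{L^\infty}\le\tfrac{\operatorname{Re}(\alpha)}4\Big\}.$$ There exists a unique $v\in1+E$ such that the couple $(u,v)$, with $u$ defined by $u(0)=1$ and $$u(x)=1+|x|\Big(\alpha+\int_{|x|}^{+\infty}\frac{v(z)-1}{z^2}\,dz\Big),\quad\forall x\neq0,$$ is a solution of the system $$\begin{cases} v'=\frac12ixv+\omega x\,\dfrac{u}{|u|^2},\\[1.2ex] u-xu'=v,\end{cases}$$ satisfying the condition $u(x)\sim\alpha|x|$ as $|x|\to+\infty$. Moreover, $|u(x)|\ge1$ for all $x\in\mathbb{R}$, and $u$ is an even, Lipschitz function on $\mathbb{R}$ with $u'\in C(\mathbb{R}\setminus\{0\})$.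
   Context: $1+E$ denotes the set of functions $1+w$ with $w\in E$. Since $u$ is in general not differentiable at $x=0$, the equation $u-xu'=v$ is understood for $x\ne0$. *)

theory Defs
  imports
    "HOL-Probability.Essential_Supremum"
    "HOL-Library.Landau_Symbols"
begin

definition even_fun :: "(real \<Rightarrow> complex) \<Rightarrow> bool"
  where "even_fun f \<longleftrightarrow> (\<forall>x. f (- x) = f x)"

definition Linf_norm :: "(real \<Rightarrow> complex) \<Rightarrow> ereal"
  where "Linf_norm f = esssup lborel (\<lambda>x. ereal (cmod (f x)))"

text \<open>In the weighted norm the point 0 carries the value 0 (division by zero), which is
  irrelevant for the essential supremum.\<close>

definition E_set :: "complex \<Rightarrow> (real \<Rightarrow> complex) set"
  where "E_set \<alpha> = {w. w C1_differentiable_on UNIV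
      \<and> w 0 = 0 \<and> vector_derivative w (at 0) = 0
      \<and> even_fun w
      \<and> Linf_norm w + Linf_norm (\<lambda>x. vector_derivative w (at x) /\<^sub>R \<bar>x\<bar>) \<le> ereal (Re \<alpha> / 4)}"

definition one_plus :: "(real \<Rightarrow> complex) set \<Rightarrow> (real \<Rightarrow> complex) set"
  where "one_plus W = (\<lambda>w x. 1 + w x) ` W"

text \<open>For \<open>v \<in> one_plus (E_set \<alpha>)\<close> and \<open>x \<noteq> 0\<close> the integrand is continuous and
  dominated by a multiple of \<open>1 / z\<^sup>2\<close> on the domain, so the Lebesgue integral is the
  (absolutely convergent) improper integral.\<close>

definition u_of :: "complex \<Rightarrow> (real \<Rightarrow> complex) \<Rightarrow> real \<Rightarrow> complex"
  where "u_of \<alpha> v x = (if x = 0 then 1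
      else 1 + \<bar>x\<bar> *\<^sub>R (\<alpha> + (LINT z:{\<bar>x\<bar>..}|lborel. (v z - 1) /\<^sub>R z\<^sup>2)))"

text \<open>The clause \<open>u x \<noteq> 0\<close> makes the quotient \<open>u / \<bar>u\<bar>\<^sup>2\<close> meaningful. The second equation is
  only required away from 0, where \<open>u\<close> need not be differentiable.\<close>

definition is_solution :: "real \<Rightarrow> (real \<Rightarrow> complex) \<Rightarrow> (real \<Rightarrow> complex) \<Rightarrow> bool"
  where "is_solution \<omega> u v \<longleftrightarrow>
      (\<forall>x. u x \<noteq> 0 \<and>
        (v has_vector_derivative
          (1 / 2 * \<i> * of_real x * v x + of_real \<omega> * of_real x * (u x / of_real ((cmod (u x))\<^sup>2)))) (at x))
    \<and> (\<forall>x. x \<noteq> 0 \<longrightarrow> u differentiable (at x)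
        \<and> u x - of_real x * vector_derivative u (at x) = v x)"

end

theory Submission
  imports Defs
begin

text \<open>
  Write \<open>R = Re \<alpha>\<close>. For \<open>v\<close> with \<open>\<bar>v - 1\<bar> \<le> R / 4\<close> and \<open>\<bar>v x - 1\<bar> \<le> R x\<^sup>2 / 8\<close> the tail integral is at
  most \<open>3 R / 8\<close>, so \<open>Re u \<ge> 1 + R \<bar>x\<bar> / 2\<close>, and \<open>\<bar>u'\<bar> \<le> 2 R\<^sup>2\<close>. For such a \<open>u\<close> the first equation is
  linear in \<open>v\<close> and is solved by Duhamel's formula. On \<open>[0, 1]\<close> the forcing is estimated trivially; on
  \<open>[1, \<infinity>)\<close> one integrates by parts against the oscillating phase, the remaining integrand being
  \<open>O(1 / x\<^sup>2)\<close>. This bounds the new \<open>v\<close> in terms of \<open>\<omega>\<close> alone. Since \<open>\<bar>u1 - u2\<bar> \<le> sup \<bar>v1 - v2\<bar>\<close>, the same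
  estimate applied to differences shows that the solution map contracts the supremum norm by a
  factor \<open>98 \<bar>\<omega>\<bar> / R\<close>.
\<close>

section \<open>Tail integrals with weight 1/z^2\<close>

definition tail_int :: "(real \<Rightarrow> complex) \<Rightarrow> real \<Rightarrow> complex"
  where "tail_int f x = (LINT z:{x..}|lborel. f z /\<^sub>R z\<^sup>2)"

lemma has_bochner_integral_inverse_square_tail:
  assumes "0 < x"
  shows "has_bochner_integral lborel (\<lambda>z::real. indicator {x..} z *\<^sub>R (A / z\<^sup>2)) (A / x)"
proof -
  have "(\<integral>\<^sup>+z. ennreal (1 / z\<^sup>2) * indicator {x..} z \<partial>lborel) = ennreal (0 - (- 1 / x))"
  proof (rule nn_integral_FTC_atLeast)
    fix z :: real assume "x \<le> z"
    with assms have "z > 0" by simp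
    then show "DERIV (\<lambda>z. - 1 / z) z :> 1 / z\<^sup>2"
      by (auto intro!: derivative_eq_intros simp: power2_eq_square)
  next
    show "((\<lambda>z::real. - 1 / z) \<longlongrightarrow> 0) at_top"
      by (rule tendsto_divide_0[OF tendsto_const filterlim_at_top_imp_at_infinity[OF filterlim_ident]])
  qed auto
  moreover have "ennreal (1 / z\<^sup>2) * indicator {x..} z = ennreal (indicator {x..} z *\<^sub>R (1 / z\<^sup>2))" for z
    by (simp add: indicator_def)
  ultimately have "has_bochner_integral lborel (\<lambda>z. indicator {x..} z *\<^sub>R (1 / z\<^sup>2)) (1 / x)"
    using assms by (intro has_bochner_integral_nn_integral) auto
  \<comment> \<open>The nonnegative integral handles the weight 1/z^2 itself; scaling afterwards
    allows \<open>A\<close> of either sign.\<close>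
  from has_bochner_integral_mult_right[OF this, of A] show ?thesis
    by (simp add: algebra_simps)
qed

lemma set_integrable_tail:
  assumes "continuous_on UNIV f" and "\<And>z. cmod (f z) \<le> A" and "0 < x"
  shows "set_integrable lborel {x..} (\<lambda>z. f z /\<^sub>R z\<^sup>2)"
proof (rule set_integrable_bound)
  show "set_integrable lborel {x..} (\<lambda>z. A / z\<^sup>2)"
    using has_bochner_integral_inverse_square_tail[OF \<open>0 < x\<close>, of A]
    by (simp add: set_integrable_def has_bochner_integral_iff)
  have "(\<lambda>z. indicator {x..} z *\<^sub>R (f z /\<^sub>R z\<^sup>2)) \<in> borel_measurable borel"
    using borel_measurable_continuous_onI[OF assms(1)] by measurable
  then show "set_borel_measurable lborel {x..} (\<lambda>z. f z /\<^sub>R z\<^sup>2)"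
    by (simp add: set_borel_measurable_def)
  show "AE z in lborel. z \<in> {x..} \<longrightarrow> norm (f z /\<^sub>R z\<^sup>2) \<le> norm (A / z\<^sup>2)"
    using assms(2) by (auto simp: divide_simps intro!: AE_I2 order_trans[OF _ abs_ge_self])
qed

lemma norm_tail_int_le:
  assumes "continuous_on UNIV f" and "\<And>z. cmod (f z) \<le> A" and "0 < x"
  shows "cmod (tail_int f x) \<le> A / x"
  unfolding tail_int_def set_lebesgue_integral_def
proof (rule Bochner_Integration.integral_norm_bound_integral[THEN order_trans])
  note h = has_bochner_integral_inverse_square_tail[OF \<open>0 < x\<close>, of A]
  show "integrable lborel (\<lambda>z. indicator {x..} z *\<^sub>R (f z /\<^sub>R z\<^sup>2))"
    using set_integrable_tail[OF assms] by (simp add: set_integrable_def)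
  show "integrable lborel (\<lambda>z. indicator {x..} z *\<^sub>R (A / z\<^sup>2))"
    "(LINT z|lborel. indicator {x..} z *\<^sub>R (A / z\<^sup>2)) \<le> A / x"
    using h by (simp_all add: has_bochner_integral_iff)
  show "norm (indicator {x..} z *\<^sub>R (f z /\<^sub>R z\<^sup>2)) \<le> indicator {x..} z *\<^sub>R (A / z\<^sup>2)" for z
    using assms(2)[of z] by (auto simp: indicator_def divide_simps)
qed

lemma tail_int_diff:
  assumes "continuous_on UNIV f" and "\<And>z. cmod (f z) \<le> A"
    and "continuous_on UNIV g" and "\<And>z. cmod (g z) \<le> B" and "0 < x"
  shows "tail_int (\<lambda>z. f z - g z) x = tail_int f x - tail_int g x"
  unfolding tail_int_def
  using set_integral_diff(2)[OF set_integrable_tail[OF assms(1,2,5)] set_integrable_tail[OF assms(3-5)]]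
  by (simp add: scaleR_diff_right)

lemma tail_int_split:
  assumes "continuous_on UNIV f" and "\<And>z. cmod (f z) \<le> A" and "0 < c" and "c \<le> x"
  shows "tail_int f x = tail_int f c - integral {c..x} (\<lambda>z. f z /\<^sub>R z\<^sup>2)"
proof -
  let ?h = "\<lambda>z. f z /\<^sub>R z\<^sup>2"
  have int: "set_integrable lborel {c..} ?h"
    using set_integrable_tail[OF assms(1-3)] .
  have "(LINT z:{c..<x}\<union>{x..}|lborel. ?h z) = (LINT z:{c..<x}|lborel. ?h z) + (LINT z:{x..}|lborel. ?h z)"
    using assms(3,4) by (intro set_integral_Un set_integrable_subset[OF int]) auto
  moreover have "{c..<x} \<union> {x..} = {c..}"
    using assms(4) by auto
  moreover have "(LINT z:{c..<x}|lborel. ?h z) = integral {c..x} ?h"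
  proof -
    have "(LINT z:{c..<x}|lborel. ?h z) = integral {c..<x} ?h"
      using assms(3,4) by (intro set_borel_integral_eq_integral set_integrable_subset[OF int]) auto
    also have "\<dots> = integral {c..x} ?h"
      using assms(4) by (intro integral_spike_set)
       (rule negligible_subset[of "{x}"], auto)+
    finally show ?thesis .
  qed
  ultimately show ?thesis
    by (simp add: tail_int_def)
qed

text \<open>Near \<open>x\<close> the tail is a constant minus an integral over a compact interval,
  to which the fundamental theorem applies. The base point x/2 lies below \<open>x\<close> and away
  from the singularity at 0.\<close>

lemma has_vector_derivative_tail_int:
  assumes "continuous_on UNIV f" and "\<And>z. cmod (f z) \<le> A" and "0 < x"
  shows "(tail_int f has_vector_derivative - (f x /\<^sub>R x\<^sup>2)) (at x)"
proof -
  let ?c = "x / 2"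
  have "((\<lambda>y. integral {?c..y} (\<lambda>z. f z /\<^sub>R z\<^sup>2)) has_vector_derivative f x /\<^sub>R x\<^sup>2) (at x within {?c..x + 1})"
    using assms(3)
    by (intro integral_has_vector_derivative continuous_intros continuous_on_subset[OF assms(1)]) auto
  then have "((\<lambda>y. integral {?c..y} (\<lambda>z. f z /\<^sub>R z\<^sup>2)) has_vector_derivative f x /\<^sub>R x\<^sup>2) (at x)"
    using assms(3) by (simp add: at_within_Icc_at)
  then have "((\<lambda>y. tail_int f ?c - integral {?c..y} (\<lambda>z. f z /\<^sub>R z\<^sup>2)) has_vector_derivative - (f x /\<^sub>R x\<^sup>2)) (at x)"
    by (auto intro!: derivative_eq_intros)
  then show ?thesis
  proof (rule has_vector_derivative_transform_within_open[where S = "{?c<..}"])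
    fix y assume "y \<in> {?c<..}"
    then show "tail_int f ?c - integral {?c..y} (\<lambda>z. f z /\<^sub>R z\<^sup>2) = tail_int f y"
      using assms(3) tail_int_split[OF assms(1,2), of ?c y] by simp
  qed (use assms(3) in auto)
qed

section \<open>The function u attached to an admissible v\<close>

lemma has_real_derivative_abs:
  fixes x :: real
  assumes "x \<noteq> 0"
  shows "(abs has_real_derivative sgn x) (at x)"
proof (rule has_field_derivative_transform_within_open)
  show "((\<lambda>y. sgn x * y) has_real_derivative sgn x) (at x)"
    by (auto intro!: derivative_eq_intros)
  show "open {y. 0 < sgn x * y}"
    by (intro open_Collect_less continuous_intros)
qed (use assms in \<open>auto simp: sgn_if split: if_splits\<close>)

text \<open>These pointwise bounds are what the estimates use of membership in 1 + E. Unlike C^1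
  regularity, they survive uniform limits, so they cut out a complete set for the fixed point
  argument. The quadratic bound is the integrated form of |w'| \<le> R |x| / 4 and forces v(0) =
  1.\<close>

locale admissible =
  fixes \<alpha> :: complex and v :: "real \<Rightarrow> complex"
  assumes Re_gt_1: "1 < Re \<alpha>"
    and norm_alpha: "cmod \<alpha> \<le> (Re \<alpha>)\<^sup>2"
    and cont_v: "continuous_on UNIV v"
    and v_bound: "cmod (v x - 1) \<le> Re \<alpha> / 4"
    and v_bound_square: "cmod (v x - 1) \<le> Re \<alpha> / 8 * x\<^sup>2"
begin

abbreviation "R \<equiv> Re \<alpha>"
abbreviation "J \<equiv> tail_int (\<lambda>z. v z - 1)"
abbreviation "u \<equiv> u_of \<alpha> v"

lemma cont_w: "continuous_on UNIV (\<lambda>z. v z - 1)"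
  by (intro continuous_intros cont_v)

text \<open>The case split at 0 disappears because the factor |x| annihilates whatever value the
  integral takes there.\<close>

lemma u_eq: "u x = 1 + \<bar>x\<bar> *\<^sub>R (\<alpha> + J \<bar>x\<bar>)"
  by (simp add: u_of_def tail_int_def)

lemma even_u: "u (- x) = u x"
  by (simp add: u_eq)

lemma u_abs: "u \<bar>x\<bar> = u x"
  by (simp add: u_eq)

text \<open>The tail beyond 1 contributes at most R/4 by the uniform bound. On [x, 1] the quadratic
  bound cancels 1/z^2 and leaves an integrand of size R/8.\<close>

lemma norm_J:
  assumes "0 < x"
  shows "cmod (J x) \<le> 3 / 8 * R"
proof -
  note far = norm_tail_int_le[OF cont_w v_bound]
  show ?thesis
  proof (cases "1 \<le> x")
    case True
    then have "R / 4 / x \<le> R / 4 / 1"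
      using Re_gt_1 by (intro divide_left_mono) auto
    then show ?thesis
      using far[OF assms] Re_gt_1 by linarith
  next
    case False
    have "cmod (integral {x..1} (\<lambda>z. (v z - 1) /\<^sub>R z\<^sup>2)) \<le> R / 8 * (1 - x)"
    proof (rule integral_bound)
      show "cmod ((v z - 1) /\<^sub>R z\<^sup>2) \<le> R / 8" if "z \<in> {x..1}" for z
        using v_bound_square[of z] that assms by (simp add: divide_simps mult.commute)
    qed (use False assms in \<open>auto intro!: continuous_intros continuous_on_subset[OF cont_v]\<close>)
    also have "\<dots> \<le> R / 8 * 1"
      using Re_gt_1 assms by (intro mult_left_mono) auto
    finally have "cmod (integral {x..1} (\<lambda>z. (v z - 1) /\<^sub>R z\<^sup>2)) \<le> R / 8"
      by simp
    moreover have "J x = J 1 + integral {x..1} (\<lambda>z. (v z - 1) /\<^sub>R z\<^sup>2)"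
      using tail_int_split[OF cont_w v_bound assms, of 1] False by simp
    ultimately show ?thesis
      using far[of 1] norm_triangle_ineq[of "J 1" "integral {x..1} (\<lambda>z. (v z - 1) /\<^sub>R z\<^sup>2)"]
      by (simp del: norm_scaleR scaleR_diff_right)
  qed
qed

text \<open>Subtracting the tail from \<alpha> leaves a real part of at least 5R/8. This gives both
  lower bounds on |u|: 1 everywhere, and R|x|/2 for large x.\<close>

lemma Re_u: "1 + R / 2 * \<bar>x\<bar> \<le> Re (u x)"
proof (cases "x = 0")
  case False
  then have "\<bar>Re (J \<bar>x\<bar>)\<bar> \<le> 3 / 8 * R"
    using norm_J[of "\<bar>x\<bar>"] abs_Re_le_cmod[of "J \<bar>x\<bar>"] by simp
  then have "R / 2 \<le> Re (\<alpha> + J \<bar>x\<bar>)"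
    using Re_gt_1 by simp
  then have "\<bar>x\<bar> * (R / 2) \<le> \<bar>x\<bar> * Re (\<alpha> + J \<bar>x\<bar>)"
    by (intro mult_left_mono) auto
  then show ?thesis
    by (simp add: u_eq mult.commute)
qed (simp add: u_eq)

lemma norm_u_ge_1: "1 \<le> cmod (u x)"
  using Re_u[of x] complex_Re_le_cmod[of "u x"] Re_gt_1
    mult_nonneg_nonneg[of "R / 2" "\<bar>x\<bar>"] by linarith

lemma norm_u_ge_linear: "R / 2 * \<bar>x\<bar> \<le> cmod (u x)"
  using Re_u[of x] complex_Re_le_cmod[of "u x"] by linarith

lemma u_nonzero: "u x \<noteq> 0"
  using norm_u_ge_1[of x] by auto

text \<open>Written this way, the derivative is the second equation solved for u'. The argument of
  \<open>v\<close> is |x| because \<open>u\<close> sees \<open>v\<close> only on the positive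
  half-line; for even \<open>v\<close> the two agree.\<close>

lemma has_vector_derivative_u:
  assumes "x \<noteq> 0"
  shows "(u has_vector_derivative (u x - v \<bar>x\<bar>) /\<^sub>R x) (at x)"
proof -
  have abs: "(abs has_vector_derivative sgn x) (at x)"
    using has_real_derivative_abs[OF assms] has_real_derivative_iff_has_vector_derivative by blast
  have "(J has_vector_derivative - ((v \<bar>x\<bar> - 1) /\<^sub>R \<bar>x\<bar>\<^sup>2)) (at \<bar>x\<bar>)"
    using assms by (intro has_vector_derivative_tail_int[OF cont_w v_bound]) auto
  from vector_diff_chain_at[OF abs this]
  have J: "((\<lambda>x. J \<bar>x\<bar>) has_vector_derivative sgn x *\<^sub>R - ((v \<bar>x\<bar> - 1) /\<^sub>R \<bar>x\<bar>\<^sup>2)) (at x)"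
    by (simp add: o_def)
  have "((\<lambda>x. 1 + \<bar>x\<bar> *\<^sub>R (\<alpha> + J \<bar>x\<bar>)) has_vector_derivative
      sgn x *\<^sub>R (\<alpha> + J \<bar>x\<bar>) + \<bar>x\<bar> *\<^sub>R (sgn x *\<^sub>R - ((v \<bar>x\<bar> - 1) /\<^sub>R \<bar>x\<bar>\<^sup>2))) (at x)"
    using has_real_derivative_abs[OF assms]
    by (auto intro!: derivative_eq_intros J)
  moreover have "sgn x *\<^sub>R (\<alpha> + J \<bar>x\<bar>) + \<bar>x\<bar> *\<^sub>R (sgn x *\<^sub>R - ((v \<bar>x\<bar> - 1) /\<^sub>R \<bar>x\<bar>\<^sup>2))
      = (u x - v \<bar>x\<bar>) /\<^sub>R x"
    using assms
    by (cases "0 < x") (auto simp: u_eq scaleR_conv_of_real divide_simps power2_eq_square algebra_simps)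
  ultimately show ?thesis
    by (simp add: u_eq[abs_def])
qed

text \<open>Here |\<alpha>| \<le> R^2 enters. In u' = \<alpha> + J - (v - 1)/x the other two terms
  are at most 3R/8 and R/4, hence together below R^2. For (v - 1)/x the quadratic bound serves on
  (0, 1] and the uniform one beyond.\<close>

lemma norm_u_deriv:
  assumes "0 < x"
  shows "cmod ((u x - v x) /\<^sub>R x) \<le> 2 * R\<^sup>2"
proof -
  have eq: "(u x - v x) /\<^sub>R x = \<alpha> + J x - (v x - 1) /\<^sub>R x"
    using assms by (simp add: u_eq scaleR_conv_of_real field_simps)
  have norm: "cmod ((v x - 1) /\<^sub>R x) = cmod (v x - 1) / x"
    using assms by (simp add: divide_inverse mult.commute)
  have "cmod ((v x - 1) /\<^sub>R x) \<le> R / 4"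
  proof (cases "x \<le> 1")
    case True
    have "cmod (v x - 1) \<le> R / 8 * (x * x)"
      using v_bound_square[of x] by (simp add: power2_eq_square)
    also have "\<dots> \<le> R / 8 * (x * 1)"
      using True assms Re_gt_1 by (intro mult_left_mono) auto
    also have "\<dots> \<le> R / 4 * x"
      using assms Re_gt_1 by simp
    finally show ?thesis
      using assms by (subst norm) (simp add: divide_le_eq)
  next
    case False
    then have "R / 4 * 1 \<le> R / 4 * x"
      using Re_gt_1 by (intro mult_left_mono) auto
    then have "cmod (v x - 1) \<le> R / 4 * x"
      using v_bound[of x] by linarith
    then show ?thesis
      using assms by (subst norm) (simp add: divide_le_eq)
  qed
  moreover have "R * 1 \<le> R * R"
    using Re_gt_1 by (intro mult_left_mono) auto
  ultimately show ?thesis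
    using norm_J[OF assms] norm_alpha Re_gt_1 norm_triangle_ineq[of \<alpha> "J x"]
      norm_triangle_ineq4[of "\<alpha> + J x" "(v x - 1) /\<^sub>R x"]
    unfolding eq power2_eq_square by linarith
qed

text \<open>The mean value inequality covers two positive points. From 0 the difference quotient is
  \<alpha> + J(y), which obeys the same bound. Evenness and ||x| - |y|| \<le> |x - y| do the
  rest.\<close>

lemma lipschitz_u: "(2 * R\<^sup>2)-lipschitz_on UNIV u"
proof -
  have near: "cmod (u y - u x) \<le> 2 * R\<^sup>2 * (y - x)" if "0 \<le> x" "x \<le> y" for x y
  proof (cases "x = 0")
    case True
    have "cmod (u y - u x) \<le> 2 * R\<^sup>2 * y" if "0 < y"
    proof -
      have "R * 1 \<le> R * R"
        using Re_gt_1 by (intro mult_left_mono) auto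
      then have "cmod (\<alpha> + J y) \<le> 2 * R\<^sup>2"
        using norm_J[OF that] norm_alpha norm_triangle_ineq[of \<alpha> "J y"] Re_gt_1
        unfolding power2_eq_square by linarith
      then show ?thesis
        using that True by (simp add: u_eq mult.commute)
    qed
    then show ?thesis
      using True that by (cases "y = 0") auto
  next
    case False
    have "norm (u y - u x) \<le> 2 * R\<^sup>2 * norm (y - x)"
    proof (rule differentiable_bound[of "{0<..}"])
      fix z :: real assume "z \<in> {0<..}"
      then have z: "0 < z" by simp
      then show "(u has_derivative (\<lambda>h. h *\<^sub>R ((u z - v z) /\<^sub>R z))) (at z within {0<..})"
        using has_vector_derivative_u[of z]
        by (auto simp: has_vector_derivative_def intro: has_derivative_at_withinI)
      show "onorm (\<lambda>h. h *\<^sub>R ((u z - v z) /\<^sub>R z)) \<le> 2 * R\<^sup>2"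
        using onorm_scaleR_left[OF bounded_linear_ident, of "(u z - v z) /\<^sub>R z"] norm_u_deriv[OF z]
        by (simp only: onorm_id[where 'a = real, unfolded id_def] mult_1)
    qed (use that False in auto)
    then show ?thesis
      using that by simp
  qed
  show ?thesis
  proof (rule lipschitz_onI)
    fix x y :: real
    have "dist (u \<bar>x\<bar>) (u \<bar>y\<bar>) \<le> 2 * R\<^sup>2 * \<bar>\<bar>x\<bar> - \<bar>y\<bar>\<bar>"
      using near[of "\<bar>x\<bar>" "\<bar>y\<bar>"] near[of "\<bar>y\<bar>" "\<bar>x\<bar>"]
      by (cases "\<bar>x\<bar> \<le> \<bar>y\<bar>") (auto simp: dist_norm norm_minus_commute)
    also have "\<dots> \<le> 2 * R\<^sup>2 * dist x y"
      by (intro mult_left_mono) (auto simp: dist_real_def)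
    finally show "dist (u x) (u y) \<le> 2 * R\<^sup>2 * dist x y"
      by (simp add: u_abs)
  qed simp
qed

lemma cont_u: "continuous_on UNIV u"
  using lipschitz_on_continuous_on[OF lipschitz_u] .

lemma C1_u:
  assumes "even_fun v"
  shows "u C1_differentiable_on (UNIV - {0})"
proof -
  have "v \<bar>x\<bar> = v x" for x
    using assms by (auto simp: even_fun_def abs_if)
  then have "\<forall>x\<in>UNIV - {0}. (u has_vector_derivative (u x - v x) /\<^sub>R x) (at x)"
    using has_vector_derivative_u by auto
  moreover have "continuous_on (UNIV - {0}) (\<lambda>x. (u x - v x) /\<^sub>R x)"
    by (intro continuous_intros continuous_on_subset[OF cont_u] continuous_on_subset[OF cont_v]) auto
  ultimately show ?thesis
    unfolding C1_differentiable_on_def by (intro exI conjI)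
qed

text \<open>The quotient u / (\<alpha> |x|) equals (1/|x| + \<alpha> + J(|x|)) / \<alpha>, and
  J(|x|) is at most R / (4|x|).\<close>

lemma asymp_equiv_u: "u \<sim>[at_infinity] (\<lambda>x. \<alpha> * of_real \<bar>x\<bar>)"
proof (rule asymp_equivI')
  have alpha: "\<alpha> \<noteq> 0"
    using Re_gt_1 by auto
  have abs: "filterlim (abs :: real \<Rightarrow> real) at_top at_infinity"
    using filterlim_at_infinity_imp_norm_at_top[of "\<lambda>x::real. x", OF filterlim_ident] by (simp add: real_norm_def[abs_def])
  have inv: "((\<lambda>x::real. c / \<bar>x\<bar>) \<longlongrightarrow> 0) at_infinity" for c :: real
    by (rule tendsto_divide_0[OF tendsto_const filterlim_at_top_imp_at_infinity[OF abs]])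
  have ev: "\<forall>\<^sub>F x in at_infinity. (x::real) \<noteq> 0"
    by (rule eventually_at_infinityI[of 1]) auto
  have "((\<lambda>x. J \<bar>x\<bar>) \<longlongrightarrow> 0) at_infinity"
    using ev norm_tail_int_le[OF cont_w v_bound]
    by (intro Lim_null_comparison[OF _ inv[of "R / 4"]]) (auto elim!: eventually_mono)
  moreover have "((\<lambda>x. complex_of_real (1 / \<bar>x\<bar>)) \<longlongrightarrow> of_real 0) at_infinity"
    by (intro tendsto_of_real inv)
  ultimately have "((\<lambda>x. (complex_of_real (1 / \<bar>x\<bar>) + (\<alpha> + J \<bar>x\<bar>)) / \<alpha>) \<longlongrightarrow> (of_real 0 + (\<alpha> + 0)) / \<alpha>) at_infinity"
    by (intro tendsto_divide tendsto_add tendsto_const alpha)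
  then have "((\<lambda>x. (complex_of_real (1 / \<bar>x\<bar>) + (\<alpha> + J \<bar>x\<bar>)) / \<alpha>) \<longlongrightarrow> 1) at_infinity"
    using alpha by simp
  moreover have "\<forall>\<^sub>F x in at_infinity. (complex_of_real (1 / \<bar>x\<bar>) + (\<alpha> + J \<bar>x\<bar>)) / \<alpha> = u x / (\<alpha> * of_real \<bar>x\<bar>)"
    using ev alpha by (auto elim!: eventually_mono simp: u_eq scaleR_conv_of_real field_simps)
  ultimately show "((\<lambda>x. u x / (\<alpha> * of_real \<bar>x\<bar>)) \<longlongrightarrow> 1) at_infinity"
    by (rule Lim_transform_eventually)
qed

end

section \<open>The oscillating phase and a bound for the linear equation\<close>

definition phase :: "real \<Rightarrow> real \<Rightarrow> complex"
  where "phase c x = exp (\<i> * of_real (c * x\<^sup>2))"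

lemma norm_phase [simp]: "cmod (phase c x) = 1"
  by (simp add: phase_def del: of_real_mult)

lemma phase_0 [simp]: "phase c 0 = 1"
  by (simp add: phase_def)

lemma phase_minus_cancel: "phase (- c) x * phase c x = 1"
  by (simp add: phase_def flip: exp_add)

text \<open>For c = 1/4 this is the homogeneous equation V' = i x V / 2, so
  \<open>phase (- 1 / 4)\<close> is the integrating factor of the first equation.\<close>

lemma has_vector_derivative_phase:
  "(phase c has_vector_derivative 2 * \<i> * of_real (c * x) * phase c x) (at x)"
proof -
  have "((\<lambda>x. \<i> * complex_of_real (c * x\<^sup>2)) has_vector_derivative \<i> * of_real (c * (2 * x))) (at x)"
    by (intro has_vector_derivative_mult_right has_vector_derivative_of_real) (auto intro!: derivative_eq_intros)
  from field_vector_diff_chain_at[OF this DERIV_exp] show ?thesis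
    by (simp add: phase_def[abs_def] o_def mult_ac)
qed

text \<open>The forcing \<open>g\<close> is kept abstract so that the bound serves a single solution
  as well as a difference of two. The integrating factor leaves \<omega> x g times a phase as
  derivative. The interval [0, 1] contributes N; beyond 1, integration by parts gives two boundary
  terms of size 2G and an integral of 2C/t^2.\<close>

lemma oscillatory_ode_bound:
  fixes \<omega> :: real and V g g' :: "real \<Rightarrow> complex"
  assumes ode: "\<And>x. 0 \<le> x \<Longrightarrow>
      (V has_vector_derivative (1 / 2 * \<i> * of_real x * V x + of_real \<omega> * of_real x * g x)) (at x)"
    and near: "\<And>x. 0 \<le> x \<Longrightarrow> x \<le> 1 \<Longrightarrow> x * cmod (g x) \<le> N"
    and g': "\<And>x. 1 \<le> x \<Longrightarrow> (g has_vector_derivative g' x) (at x)"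
    and g_bound: "\<And>x. 1 \<le> x \<Longrightarrow> cmod (g x) \<le> G"
    and g'_bound: "\<And>x. 1 \<le> x \<Longrightarrow> cmod (g' x) \<le> C / x\<^sup>2"
    and "0 \<le> x"
  shows "cmod (phase (- 1 / 4) x * V x - V 0) \<le> \<bar>\<omega>\<bar> * (N + 4 * G + 2 * C)"
proof -
  let ?e = "phase (- 1 / 4)"
  define F where "F = (\<lambda>x. ?e x * V x)"
  have nonneg: "0 \<le> N" "0 \<le> G" "0 \<le> C"
    using near[of 0] order_trans[OF norm_ge_zero g_bound[of 1]] order_trans[OF norm_ge_zero g'_bound[of 1]]
    by auto
  have F': "(F has_vector_derivative ?e t * (of_real \<omega> * of_real t * g t)) (at t)" if "0 \<le> t" for t
    unfolding F_def
    by (rule has_vector_derivative_eq_rhs[OF has_vector_derivative_mult[OF has_vector_derivative_phase ode[OF that]]])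
      (simp add: algebra_simps)
  have cont_F: "continuous_on {0..b} F" for b
    by (rule continuous_on_vector_derivative[OF has_vector_derivative_at_within[OF F']]) auto
  have near_F: "cmod (F t - F 0) \<le> \<bar>\<omega>\<bar> * N" if "0 \<le> t" "t \<le> 1" for t
  proof (cases "t = 0")
    case False
    have "cmod (F t - F 0) \<le> \<bar>\<omega>\<bar> * N * t - \<bar>\<omega>\<bar> * N * 0"
    proof (rule differentiable_bound_general[where \<phi>' = "\<lambda>_. \<bar>\<omega>\<bar> * N"])
      fix s assume s: "0 < s" "s < t"
      then show "(F has_vector_derivative ?e s * (of_real \<omega> * of_real s * g s)) (at s)"
        by (intro F') auto
      have "\<bar>\<omega>\<bar> * (s * cmod (g s)) \<le> \<bar>\<omega>\<bar> * N"
        using s that by (intro mult_left_mono near) auto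
      then show "cmod (?e s * (of_real \<omega> * of_real s * g s)) \<le> \<bar>\<omega>\<bar> * N"
        using s by (simp add: norm_mult mult.assoc)
    qed (use that False in \<open>auto intro!: cont_F continuous_intros derivative_eq_intros\<close>)
    also have "\<dots> \<le> \<bar>\<omega>\<bar> * N * 1 - \<bar>\<omega>\<bar> * N * 0"
      using that nonneg by (intro diff_right_mono mult_left_mono) auto
    finally show ?thesis by simp
  qed (use nonneg in auto)
  have "cmod (F x - F 0) \<le> \<bar>\<omega>\<bar> * (N + 4 * G + 2 * C)"
  proof (cases "x \<le> 1")
    case True
    have "\<bar>\<omega>\<bar> * N \<le> \<bar>\<omega>\<bar> * (N + 4 * G + 2 * C)"
      using nonneg by (intro mult_left_mono) auto
    then show ?thesis
      using near_F[OF \<open>0 \<le> x\<close> True] by linarith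
  next
    case False
    \<comment> \<open>Integration by parts: the derivative of \<open>2 * \<i> * phase (- 1 / 4) x\<close> is \<open>x * phase (- 1 / 4) x\<close>,
      so subtracting \<open>B\<close> from \<open>F\<close> leaves an integrable derivative.\<close>
    define B where "B = (\<lambda>t. 2 * \<i> * of_real \<omega> * (?e t * g t))"
    have B: "cmod (B t) \<le> 2 * \<bar>\<omega>\<bar> * G" if "1 \<le> t" for t
      using mult_left_mono[OF g_bound[OF that], of "2 * \<bar>\<omega>\<bar>"] by (simp add: B_def norm_mult mult.assoc)
    define H where "H = (\<lambda>t. F t - B t)"
    have H': "(H has_vector_derivative - 2 * \<i> * of_real \<omega> * (?e t * g' t)) (at t)" if "1 \<le> t" for t
    proof -
      have "(B has_vector_derivative 2 * \<i> * of_real \<omega> *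
          (?e t * g' t + 2 * \<i> * of_real (- 1 / 4 * t) * ?e t * g t)) (at t)"
        unfolding B_def
        by (intro has_vector_derivative_mult_right has_vector_derivative_mult has_vector_derivative_phase g' that)
      then have "(H has_vector_derivative ?e t * (of_real \<omega> * of_real t * g t) - 2 * \<i> * of_real \<omega> *
          (?e t * g' t + 2 * \<i> * of_real (- 1 / 4 * t) * ?e t * g t)) (at t)"
        unfolding H_def using that by (intro has_vector_derivative_diff F') auto
      then show ?thesis
        by (rule has_vector_derivative_eq_rhs) (simp add: algebra_simps)
    qed
    \<comment> \<open>The comparison function is an antiderivative of 2 |\<omega>| C / t^2. It is
      bounded on [1, x] independently of \<open>x\<close>.\<close>
    have "cmod (H x - H 1) \<le> - (2 * \<bar>\<omega>\<bar> * C) / x - - (2 * \<bar>\<omega>\<bar> * C) / 1"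
    proof (rule differentiable_bound_general[where \<phi>' = "\<lambda>t. 2 * \<bar>\<omega>\<bar> * C / t\<^sup>2"])
      show "continuous_on {1..x} H"
        by (rule continuous_on_vector_derivative[OF has_vector_derivative_at_within[OF H']]) auto
      show "continuous_on {1..x} (\<lambda>t. - (2 * \<bar>\<omega>\<bar> * C) / t)"
        by (intro continuous_intros) auto
      fix t assume t: "1 < t" "t < x"
      then show "(H has_vector_derivative - 2 * \<i> * of_real \<omega> * (?e t * g' t)) (at t)"
        by (intro H') auto
      have "((\<lambda>t. - (2 * \<bar>\<omega>\<bar> * C) / t) has_real_derivative 2 * \<bar>\<omega>\<bar> * C / t\<^sup>2) (at t)"
        using t by (auto intro!: derivative_eq_intros simp: power2_eq_square)
      then show "((\<lambda>t. - (2 * \<bar>\<omega>\<bar> * C) / t) has_vector_derivative 2 * \<bar>\<omega>\<bar> * C / t\<^sup>2) (at t)"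
        by (simp add: has_real_derivative_iff_has_vector_derivative)
      show "cmod (- 2 * \<i> * of_real \<omega> * (?e t * g' t)) \<le> 2 * \<bar>\<omega>\<bar> * C / t\<^sup>2"
        using mult_left_mono[OF g'_bound[of t], of "2 * \<bar>\<omega>\<bar>"] t by (simp add: norm_mult mult.assoc)
    qed (use False in auto)
    also have "\<dots> \<le> 2 * \<bar>\<omega>\<bar> * C"
      using False nonneg by (simp add: divide_simps)
    finally have "cmod (H x - H 1) \<le> 2 * \<bar>\<omega>\<bar> * C" .
    moreover have eq: "F x - F 0 = (F 1 - F 0) + ((H x - H 1) + (B x - B 1))"
      by (simp add: H_def)
    ultimately have "cmod (F x - F 0) \<le> \<bar>\<omega>\<bar> * N + (2 * \<bar>\<omega>\<bar> * C + (2 * \<bar>\<omega>\<bar> * G + 2 * \<bar>\<omega>\<bar> * G))"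
      unfolding eq using near_F[of 1] B[of x] B[of 1] False
      by (intro norm_triangle_mono order_trans[OF norm_triangle_ineq4 add_mono, of "B x"]) auto
    then show ?thesis
      by (simp add: algebra_simps)
  qed
  then show ?thesis
    by (simp add: F_def)
qed

section \<open>Size of solutions of the linear equation\<close>

context admissible
begin

text \<open>The nonlinearity u/|u|^2 equals 1/cnj u, a holomorphic function composed with the curve
  cnj u, so the chain rule applies.\<close>

lemma has_vector_derivative_inverse_cnj_u:
  assumes "0 < x"
  shows "((\<lambda>x. 1 / cnj (u x)) has_vector_derivative - cnj ((u x - v x) /\<^sub>R x / (u x)\<^sup>2)) (at x)"
proof -
  have "((\<lambda>x. cnj (u x)) has_vector_derivative cnj ((u x - v x) /\<^sub>R x)) (at x)"
    using has_vector_derivative_u[of x] assms by (intro has_vector_derivative_cnj) auto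
  moreover have "((\<lambda>z. 1 / z) has_field_derivative - 1 / (cnj (u x))\<^sup>2) (at (cnj (u x)))"
    using u_nonzero[of x] by (auto intro!: derivative_eq_intros simp: power2_eq_square)
  ultimately have "(((\<lambda>z. 1 / z) \<circ> (\<lambda>x. cnj (u x))) has_vector_derivative
      cnj ((u x - v x) /\<^sub>R x) * (- 1 / (cnj (u x))\<^sup>2)) (at x)"
    by (rule field_vector_diff_chain_at)
  then show ?thesis
    by (simp add: o_def)
qed

lemma norm_inverse_u_le:
  assumes "0 < x"
  shows "cmod (1 / u x) \<le> 2 / (R * x)"
proof -
  have "0 < R * x"
    using assms Re_gt_1 by simp
  moreover have "R * x / 2 \<le> cmod (u x)"
    using norm_u_ge_linear[of x] assms by simp
  ultimately show ?thesis
    using u_nonzero[of x] by (simp add: norm_divide divide_simps)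
qed

lemma norm_inverse_u_le_1: "cmod (1 / u x) \<le> 1"
  using norm_u_ge_1[of x] u_nonzero[of x] by (simp add: norm_divide divide_simps)

text \<open>The oscillatory bound is applied with N = G = 1 and C = 8, and 1 + 4 + 16 = 21. The
  constant 8 comes from |u'| / |u|^2 \<le> 2R^2 (2/(R x))^2, where all powers of R cancel; hence the
  bound depends on \<omega> alone.\<close>

lemma solution_bound:
  assumes ode: "\<And>x. (V has_vector_derivative
      (1 / 2 * \<i> * of_real x * V x + of_real \<omega> * of_real x * (1 / cnj (u x)))) (at x)"
    and V0: "V 0 = 1" and even: "even_fun V"
  shows "cmod (V x) \<le> 1 + 21 * \<bar>\<omega>\<bar>"
proof -
  have pos: "cmod (V x) \<le> 1 + 21 * \<bar>\<omega>\<bar>" if "0 \<le> x" for x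
  proof -
    have "cmod (phase (- 1 / 4) x * V x - V 0) \<le> \<bar>\<omega>\<bar> * (1 + 4 * 1 + 2 * 8)"
    proof (rule oscillatory_ode_bound[OF ode _ has_vector_derivative_inverse_cnj_u _ _ that])
      fix x :: real
      show "cmod (1 / cnj (u x)) \<le> 1"
        using norm_inverse_u_le_1[of x] by (simp add: norm_divide)
      then show "x * cmod (1 / cnj (u x)) \<le> 1" if "0 \<le> x" "x \<le> 1"
        using mult_mono[of x 1 "cmod (1 / cnj (u x))" 1] that by auto
      assume x: "1 \<le> x"
      have "cmod ((u x - v x) /\<^sub>R x / (u x)\<^sup>2) = cmod ((u x - v x) /\<^sub>R x) * (cmod (1 / u x))\<^sup>2"
        by (simp add: norm_divide norm_power power_divide)
      also have "\<dots> \<le> 2 * R\<^sup>2 * (2 / (R * x))\<^sup>2"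
        using x by (intro mult_mono norm_u_deriv power_mono norm_inverse_u_le) auto
      also have "\<dots> = 8 / x\<^sup>2"
        using Re_gt_1 x by (simp add: field_simps)
      finally show "cmod (- cnj ((u x - v x) /\<^sub>R x / (u x)\<^sup>2)) \<le> 8 / x\<^sup>2"
        by (simp only: norm_minus_cancel complex_mod_cnj)
    qed auto
    moreover have "cmod (V x) = cmod (phase (- 1 / 4) x * V x)"
      by (simp add: norm_mult)
    ultimately show ?thesis
      using norm_triangle_sub[of "phase (- 1 / 4) x * V x" 1] V0 by simp
  qed
  show ?thesis
    using pos[of x] pos[of "- x"] even by (cases "0 \<le> x") (auto simp: even_fun_def)
qed

end

section \<open>Dependence of the solution on v\<close>

text \<open>In the difference \<alpha> cancels, and the decay D/|x| of the remaining tail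
  compensates the factor |x|.\<close>

lemma norm_u_of_diff_le:
  assumes "admissible \<alpha> v1" and "admissible \<alpha> v2" and D: "\<And>x. cmod (v1 x - v2 x) \<le> D"
  shows "cmod (u_of \<alpha> v1 x - u_of \<alpha> v2 x) \<le> D"
proof -
  interpret v1: admissible \<alpha> v1 by fact
  interpret v2: admissible \<alpha> v2 by fact
  show ?thesis
  proof (cases "x = 0")
    case True
    then show ?thesis
      using order_trans[OF norm_ge_zero D[of 0]] by (simp add: u_of_def)
  next
    case False
    have "v1.J \<bar>x\<bar> - v2.J \<bar>x\<bar> = tail_int (\<lambda>z. v1 z - v2 z) \<bar>x\<bar>"
      using tail_int_diff[OF v1.cont_w v1.v_bound v2.cont_w v2.v_bound, of "\<bar>x\<bar>"] False by simp
    moreover have "cmod (tail_int (\<lambda>z. v1 z - v2 z) \<bar>x\<bar>) \<le> D / \<bar>x\<bar>"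
      using False by (intro norm_tail_int_le D continuous_intros v1.cont_v v2.cont_v) auto
    moreover have "u_of \<alpha> v1 x - u_of \<alpha> v2 x = \<bar>x\<bar> *\<^sub>R (v1.J \<bar>x\<bar> - v2.J \<bar>x\<bar>)"
      by (simp add: v1.u_eq v2.u_eq scaleR_conv_of_real algebra_simps)
    ultimately show ?thesis
      using False by (simp add: field_simps)
  qed
qed

lemma norm_inverse_diff_le:
  fixes a b :: complex
  assumes "a \<noteq> 0" and "b \<noteq> 0" and "cmod (a - b) \<le> D"
  shows "cmod (1 / a - 1 / b) \<le> D * (cmod (1 / a) * cmod (1 / b))"
proof -
  have "1 / a - 1 / b = - (a - b) * ((1 / a) * (1 / b))"
    using assms by (simp add: field_simps)
  then have "cmod (1 / a - 1 / b) = cmod (a - b) * (cmod (1 / a) * cmod (1 / b))"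
    by (simp only: norm_mult norm_minus_cancel)
  then show ?thesis
    using assms by (simp only: mult_right_mono mult_nonneg_nonneg norm_ge_zero)
qed

text \<open>The difference V1 - V2 vanishes at 0 and solves the linear equation with the difference
  of the forcings. Its constants all carry a factor D/R, namely N = 2D/R, G = 4D/R and C = 40D/R,
  and 2 + 16 + 80 = 98. Since 196 |\<omega>| < R, the factor 98 |\<omega>| / R is below 1/2.\<close>

lemma solution_contraction:
  assumes "admissible \<alpha> v1" and "admissible \<alpha> v2" and D: "\<And>x. cmod (v1 x - v2 x) \<le> D"
    and large: "20 + 200 * \<bar>\<omega>\<bar> < Re \<alpha>"
    and ode1: "\<And>x. (V1 has_vector_derivative
      (1 / 2 * \<i> * of_real x * V1 x + of_real \<omega> * of_real x * (1 / cnj (u_of \<alpha> v1 x)))) (at x)"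
    and ode2: "\<And>x. (V2 has_vector_derivative
      (1 / 2 * \<i> * of_real x * V2 x + of_real \<omega> * of_real x * (1 / cnj (u_of \<alpha> v2 x)))) (at x)"
    and init: "V1 0 = V2 0" and even: "even_fun V1" "even_fun V2"
  shows "cmod (V1 x - V2 x) \<le> D / 2"
proof -
  interpret v1: admissible \<alpha> v1 by fact
  interpret v2: admissible \<alpha> v2 by fact
  let ?R = "Re \<alpha>"
  have R: "1 < ?R" by (rule v1.Re_gt_1)
  have D0: "0 \<le> D" using order_trans[OF norm_ge_zero D[of 0]] .
  let ?g = "\<lambda>x. 1 / cnj (v1.u x) - 1 / cnj (v2.u x)"
  let ?p = "\<lambda>x. (v1.u x - v1 x) /\<^sub>R x" and ?q = "\<lambda>x. (v2.u x - v2 x) /\<^sub>R x"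
  let ?g' = "\<lambda>x. - cnj (?p x / (v1.u x)\<^sup>2) - - cnj (?q x / (v2.u x)\<^sup>2)"
  note u_diff = norm_u_of_diff_le[OF assms(1-3)]
  have g: "cmod (?g x) = cmod (1 / v1.u x - 1 / v2.u x)" for x
  proof -
    have "?g x = cnj (1 / v1.u x - 1 / v2.u x)" by simp
    then show ?thesis by (simp only: complex_mod_cnj)
  qed
  have g_le: "cmod (?g x) \<le> D * (cmod (1 / v1.u x) * cmod (1 / v2.u x))" for x
    unfolding g by (rule norm_inverse_diff_le[OF v1.u_nonzero v2.u_nonzero u_diff])
  have g_far: "cmod (1 / v1.u x - 1 / v2.u x) \<le> D * (2 / (?R * x) * (2 / (?R * x)))" if "0 < x" for x
    using g_le[of x] D0 that R v1.norm_inverse_u_le[OF that] v2.norm_inverse_u_le[OF that]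
    unfolding g by (elim order_trans, intro mult_left_mono mult_mono) auto
  have pos: "cmod (V1 x - V2 x) \<le> D / 2" if "0 \<le> x" for x
  proof -
    have "cmod (phase (- 1 / 4) x * (V1 x - V2 x) - (V1 0 - V2 0))
        \<le> \<bar>\<omega>\<bar> * (2 * D / ?R + 4 * (4 * D / ?R) + 2 * (40 * D / ?R))"
    proof (rule oscillatory_ode_bound[where g' = ?g'])
      fix x :: real
      show "((\<lambda>x. V1 x - V2 x) has_vector_derivative
          1 / 2 * \<i> * of_real x * (V1 x - V2 x) + of_real \<omega> * of_real x * ?g x) (at x)"
        by (rule has_vector_derivative_eq_rhs[OF has_vector_derivative_diff[OF ode1 ode2]])
          (simp add: field_simps)
    next
      fix x :: real assume x: "0 \<le> x" "x \<le> 1"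
      show "x * cmod (?g x) \<le> 2 * D / ?R"
      proof (cases "x = 0")
        case False
        with x have "0 < x" by simp
        \<comment> \<open>Near 0 the factor \<open>x\<close> cancels the 1/x in the bound of one
          reciprocal, which supplies the gain 1/R; the other reciprocal is bounded by 1.\<close>
        have "x * (D * (cmod (1 / v1.u x) * cmod (1 / v2.u x))) \<le> x * (D * (2 / (?R * x) * 1))"
          using R D0 \<open>0 < x\<close> v1.norm_inverse_u_le[OF \<open>0 < x\<close>] v2.norm_inverse_u_le_1[of x]
          by (intro mult_left_mono mult_mono) auto
        also have "\<dots> = 2 * D / ?R"
          using \<open>0 < x\<close> by simp
        finally show ?thesis
          using mult_left_mono[OF g_le[of x], of x] x by linarith
      qed (use R D0 in auto)
    next
      fix x :: real assume x: "1 \<le> x"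
      show "(?g has_vector_derivative ?g' x) (at x)"
        using x by (intro has_vector_derivative_diff v1.has_vector_derivative_inverse_cnj_u
            v2.has_vector_derivative_inverse_cnj_u) auto
    next
      fix x :: real assume x: "1 \<le> x"
      have "1 * 1 \<le> ?R * (x * x)"
        using x R mult_mono[of 1 x 1 x] by (intro mult_mono) auto
      then have "D * (2 / (?R * x) * (2 / (?R * x))) \<le> 4 * D / ?R"
        using R x D0 by (simp add: field_simps mult_left_mono)
      then show "cmod (?g x) \<le> 4 * D / ?R"
        using g_far[of x] x unfolding g by linarith
    next
      fix x :: real assume x: "1 \<le> x"
      let ?a = "1 / v1.u x" and ?b = "1 / v2.u x" and ?m = "2 / (?R * x)"
      have m: "cmod ?a \<le> ?m" "cmod ?b \<le> ?m" "0 \<le> ?m"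
        using v1.norm_inverse_u_le[of x] v2.norm_inverse_u_le[of x] x R by auto
      have pq: "cmod (?p x - ?q x) \<le> 2 * D / x"
      proof -
        have "?p x - ?q x = ((v1.u x - v2.u x) - (v1 x - v2 x)) /\<^sub>R x"
          by (simp add: scaleR_diff_right)
        then have "cmod (?p x - ?q x) = cmod ((v1.u x - v2.u x) - (v1 x - v2 x)) / x"
          using x by (simp add: divide_inverse mult.commute)
        also have "\<dots> \<le> (D + D) / x"
          using x by (intro divide_right_mono norm_triangle_le_diff add_mono u_diff D) auto
        finally show ?thesis by simp
      qed
      have q: "cmod (?q x) \<le> 2 * ?R\<^sup>2"
        using v2.norm_u_deriv[of x] x by auto
      have ab: "cmod (?a - ?b) \<le> D * (?m * ?m)"
        using g_far[of x] x by auto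
      \<comment> \<open>This separates the change of u' from the change of 1/u^2, the latter
        factored as a difference of squares.\<close>
      have "p / U\<^sup>2 - q / W\<^sup>2 = (p - q) * (1 / U)\<^sup>2 + q * ((1 / U - 1 / W) * (1 / U + 1 / W))"
        for p q U W :: complex
        by (simp add: algebra_simps power2_eq_square diff_divide_distrib)
      moreover have "- cnj A - - cnj B = - cnj (A - B)" for A B
        by simp
      ultimately have "?g' x = - cnj ((?p x - ?q x) * ?a\<^sup>2 + ?q x * ((?a - ?b) * (?a + ?b)))"
        by presburger
      then have "cmod (?g' x) = cmod ((?p x - ?q x) * ?a\<^sup>2 + ?q x * ((?a - ?b) * (?a + ?b)))"
        by (simp only: norm_minus_cancel complex_mod_cnj)
      also have "\<dots> \<le> 2 * D / x * ?m\<^sup>2 + 2 * ?R\<^sup>2 * (D * (?m * ?m) * (?m + ?m))"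
        using m D0 x unfolding norm_mult norm_power
        by (intro norm_triangle_mono; simp only: norm_mult norm_power)
          (intro mult_mono power_mono pq q ab norm_triangle_mono | simp)+
      also have "\<dots> \<le> 40 * D / ?R / x\<^sup>2"
      proof -
        \<comment> \<open>The growth R^2 of u' meets three reciprocals of size 2/(R x), so one
          factor 1/R survives. The two terms are 8D/(R^2 x^3) and 32D/(R x^3).\<close>
        have "2 * D / x * ?m\<^sup>2 + 2 * ?R\<^sup>2 * (D * (?m * ?m) * (?m + ?m))
            = (8 * D / ?R * (1 / ?R) + 32 * D / ?R) * (1 / x) / x\<^sup>2"
          using R x by (simp add: field_simps power2_eq_square)
        also have "\<dots> \<le> (8 * D / ?R * 1 + 32 * D / ?R) * 1 / x\<^sup>2"
          using R x D0 by (intro divide_right_mono mult_mono add_mono mult_left_mono) auto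
        finally show ?thesis by (simp add: field_simps)
      qed
      finally show "cmod (?g' x) \<le> 40 * D / ?R / x\<^sup>2" .
    qed (rule that)
    also have "\<dots> = 98 * \<bar>\<omega>\<bar> / ?R * D"
      using R by (simp add: field_simps)
    also have "\<dots> \<le> 1 / 2 * D"
      using R large D0 by (intro mult_right_mono) (auto simp: field_simps)
    finally show ?thesis
      using init by (simp add: norm_mult)
  qed
  show ?thesis
    using pos[of x] pos[of "- x"] even by (cases "0 \<le> x") (auto simp: even_fun_def)
qed

section \<open>From the norm of E to pointwise bounds\<close>

lemma norm_le_square_if_deriv_le_linear:
  fixes w :: "real \<Rightarrow> complex"
  assumes w': "\<And>x. (w has_vector_derivative w' x) (at x)" and "w 0 = 0" and "even_fun w"
    and bound: "\<And>x. cmod (w' x) \<le> c * \<bar>x\<bar>"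
  shows "cmod (w x) \<le> c / 2 * x\<^sup>2"
proof -
  have pos: "cmod (w x) \<le> c / 2 * x\<^sup>2" if "0 < x" for x
  proof -
    have "cmod (w x - w 0) \<le> c / 2 * x\<^sup>2 - c / 2 * 0\<^sup>2"
    proof (rule differentiable_bound_general[where \<phi>' = "\<lambda>x. c * x"])
      show "continuous_on {0..x} w"
        by (rule continuous_on_vector_derivative[OF has_vector_derivative_at_within[OF w']])
      show "((\<lambda>x. c / 2 * x\<^sup>2) has_vector_derivative c * t) (at t)" for t
        unfolding has_real_derivative_iff_has_vector_derivative[symmetric]
        by (auto intro!: derivative_eq_intros)
      show "cmod (w' t) \<le> c * t" if "0 < t" for t
        using bound[of t] that by simp
    qed (auto intro!: continuous_intros w' that)
    then show ?thesis
      using \<open>w 0 = 0\<close> by simp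
  qed
  consider "x = 0" | "0 < x" | "0 < - x" by linarith
  then show ?thesis
    using pos[of x] pos[of "- x"] \<open>w 0 = 0\<close> \<open>even_fun w\<close> by cases (auto simp: even_fun_def)
qed

lemma Linf_norm_nonneg: "0 \<le> Linf_norm f"
proof -
  have "esssup lborel (\<lambda>x::real. 0::ereal) \<le> esssup lborel (\<lambda>x. ereal (cmod (f x)))"
    by (rule esssup_mono) auto
  then show ?thesis
    by (simp add: Linf_norm_def esssup_const)
qed

lemma AE_norm_le_if_Linf_norm_le:
  assumes "Linf_norm f \<le> ereal c"
  shows "AE x in lborel. cmod (f x) \<le> c"
proof -
  have "AE x in lborel. ereal (cmod (f x)) \<le> Linf_norm f"
    unfolding Linf_norm_def by (rule esssup_AE)
  then show ?thesis
  proof eventually_elim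
    case (elim x)
    then have "ereal (cmod (f x)) \<le> ereal c"
      using assms by (rule order_trans)
    then show ?case by simp
  qed
qed

lemma Linf_norm_le:
  assumes "f \<in> borel_measurable borel" and "\<And>x. cmod (f x) \<le> c"
  shows "Linf_norm f \<le> ereal c"
  unfolding Linf_norm_def
  by (rule esssup_I) (use assms in auto)

text \<open>An almost everywhere bound between continuous functions holds on a closed set of full
  measure, which is the whole line. The weighted derivative bound is then integrated from 0, turning
  R/4 into R/8.\<close>

lemma E_setD:
  assumes "w \<in> E_set \<alpha>"
  shows "continuous_on UNIV w" and "cmod (w x) \<le> Re \<alpha> / 4" and "cmod (w x) \<le> Re \<alpha> / 8 * x\<^sup>2"
proof -
  let ?w' = "\<lambda>x. vector_derivative w (at x)"
  from assms obtain D where D: "\<And>x. (w has_vector_derivative D x) (at x)" "continuous_on UNIV D"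
    and w: "w 0 = 0" "even_fun w"
    and sum: "Linf_norm w + Linf_norm (\<lambda>x. ?w' x /\<^sub>R \<bar>x\<bar>) \<le> ereal (Re \<alpha> / 4)"
    unfolding E_set_def C1_differentiable_on_def by auto
  have w': "?w' x = D x" for x
    by (rule vector_derivative_at[OF D(1)])
  show cont: "continuous_on UNIV w"
    by (rule continuous_on_vector_derivative[OF has_vector_derivative_at_within[OF D(1)]])
  have "AE x in lebesgue. x \<in> {x. cmod (w x) \<le> Re \<alpha> / 4}"
  proof -
    have "Linf_norm w + 0 \<le> Linf_norm w + Linf_norm (\<lambda>x. ?w' x /\<^sub>R \<bar>x\<bar>)"
      by (intro add_left_mono Linf_norm_nonneg)
    then have "Linf_norm w \<le> ereal (Re \<alpha> / 4)"
      using sum by simp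
    from AE_norm_le_if_Linf_norm_le[OF this] show ?thesis
      by (simp add: AE_completion)
  qed
  moreover have "closed {x. cmod (w x) \<le> Re \<alpha> / 4}"
    by (intro closed_Collect_le continuous_intros cont)
  ultimately show "cmod (w x) \<le> Re \<alpha> / 4" for x
    using mem_closed_if_AE_lebesgue by blast
  \<comment> \<open>The weight is multiplied out because both sides are then continuous at 0 as
    well. The point 0 itself is discarded as a null set, since the quotient there is 0 by convention
    and says nothing about \<open>D 0\<close>.\<close>
  have "AE x in lebesgue. x \<in> {x. cmod (D x) \<le> Re \<alpha> / 4 * \<bar>x\<bar>}"
  proof -
    have "0 + Linf_norm (\<lambda>x. ?w' x /\<^sub>R \<bar>x\<bar>) \<le> Linf_norm w + Linf_norm (\<lambda>x. ?w' x /\<^sub>R \<bar>x\<bar>)"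
      by (intro add_right_mono Linf_norm_nonneg)
    then have "Linf_norm (\<lambda>x. ?w' x /\<^sub>R \<bar>x\<bar>) \<le> ereal (Re \<alpha> / 4)"
      using sum by simp
    from AE_norm_le_if_Linf_norm_le[OF this]
    have "AE x in lborel. cmod (D x) \<le> Re \<alpha> / 4 * \<bar>x\<bar>"
      using AE_lborel_singleton[of 0] by eventually_elim (simp add: w' divide_simps)
    then show ?thesis
      by (simp add: AE_completion)
  qed
  moreover have "closed {x. cmod (D x) \<le> Re \<alpha> / 4 * \<bar>x\<bar>}"
    by (intro closed_Collect_le continuous_intros D(2))
  ultimately have "cmod (D x) \<le> Re \<alpha> / 4 * \<bar>x\<bar>" for x
    using mem_closed_if_AE_lebesgue by blast
  from norm_le_square_if_deriv_le_linear[OF D(1) w this] show "cmod (w x) \<le> Re \<alpha> / 8 * x\<^sup>2" for x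
    by simp
qed

lemma one_plus_E_setD:
  assumes "v \<in> one_plus (E_set \<alpha>)" and "1 < Re \<alpha>" and "cmod \<alpha> \<le> (Re \<alpha>)\<^sup>2"
  shows "admissible \<alpha> v" and "even_fun v" and "v 0 = 1"
proof -
  from assms(1) obtain w where w: "w \<in> E_set \<alpha>" and v: "v = (\<lambda>x. 1 + w x)"
    by (auto simp: one_plus_def)
  then show "even_fun v" "v 0 = 1"
    by (auto simp: E_set_def even_fun_def)
  show "admissible \<alpha> v"
    unfolding v using assms(2,3) E_setD[OF w] by unfold_locales (auto intro!: continuous_intros)
qed

section \<open>Reduction of the system to its first equation\<close>

context admissible
begin

lemma v_in_bcontfun: "v \<in> bcontfun"
proof -
  have "cmod (v x) \<le> 1 + R / 4" for x
    using norm_triangle_sub[of "v x" 1] v_bound[of x] by simp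
  then have "bounded (range v)"
    unfolding bounded_iff by blast
  then show ?thesis
    using cont_v by (simp add: bcontfun_def)
qed

lemma recip_u: "u x / of_real ((cmod (u x))\<^sup>2) = 1 / cnj (u x)"
  unfolding complex_norm_square using u_nonzero[of x] by simp

text \<open>The second equation holds by the construction of \<open>u\<close>, once evenness
  identifies v(|x|) with v(x); only the first remains as a condition.\<close>

lemma is_solution_u_iff:
  assumes "even_fun v"
  shows "is_solution \<omega> u v \<longleftrightarrow> (\<forall>x. (v has_vector_derivative
      (1 / 2 * \<i> * of_real x * v x + of_real \<omega> * of_real x * (1 / cnj (u x)))) (at x))"
proof -
  have "u differentiable (at x) \<and> u x - of_real x * vector_derivative u (at x) = v x" if "x \<noteq> 0" for x
  proof -
    have "v \<bar>x\<bar> = v x"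
      using assms by (auto simp: even_fun_def abs_if)
    then have "(u has_vector_derivative (u x - v x) /\<^sub>R x) (at x)"
      using has_vector_derivative_u[OF that] by simp
    then show ?thesis
      using that by (auto simp: vector_derivative_at scaleR_conv_of_real mult.assoc[symmetric] intro: differentiableI_vector)
  qed
  then show ?thesis
    unfolding is_solution_def recip_u using u_nonzero by blast
qed

end

text \<open>Here \<open>v\<close> only enters through \<open>u\<close>, and \<open>V\<close> solves the resulting linear equation; solutions
  of the nonlinear system are the case \<open>V = v\<close>.\<close>

locale solution = admissible +
  fixes \<omega> :: real and V :: "real \<Rightarrow> complex"
  assumes large: "20 + 200 * \<bar>\<omega>\<bar> < Re \<alpha>"
    and ode: "(V has_vector_derivative
      (1 / 2 * \<i> * of_real x * V x + of_real \<omega> * of_real x * (1 / cnj (u x)))) (at x)"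
    and V_0: "V 0 = 1" and even_V: "even_fun V"
begin

abbreviation "V' x \<equiv> 1 / 2 * \<i> * of_real x * V x + of_real \<omega> * of_real x * (1 / cnj (u x))"

lemma cont_V: "continuous_on UNIV V"
  by (rule continuous_on_vector_derivative[OF has_vector_derivative_at_within[OF ode]])

lemma norm_V_minus_1: "cmod (V x - 1) \<le> 2 + 21 * \<bar>\<omega>\<bar>"
  using solution_bound[OF ode V_0 even_V, of x] norm_triangle_ineq4[of "V x" 1] by simp

text \<open>Both terms of the equation carry a factor \<open>x\<close>, which is what the weight
  1/|x| in the norm of E asks for.\<close>

lemma norm_V': "cmod (V' x) \<le> (1 / 2 + 12 * \<bar>\<omega>\<bar>) * \<bar>x\<bar>"
proof -
  have "V' x = of_real x * (\<i> / 2 * V x + of_real \<omega> * (1 / cnj (u x)))"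
    by (simp add: field_simps)
  then have "cmod (V' x) = \<bar>x\<bar> * cmod (\<i> / 2 * V x + of_real \<omega> * (1 / cnj (u x)))"
    by (simp only: norm_mult norm_of_real)
  also have "\<dots> \<le> \<bar>x\<bar> * (1 / 2 * (1 + 21 * \<bar>\<omega>\<bar>) + \<bar>\<omega>\<bar> * 1)"
  proof (intro mult_left_mono norm_triangle_mono)
    show "cmod (\<i> / 2 * V x) \<le> 1 / 2 * (1 + 21 * \<bar>\<omega>\<bar>)"
      using solution_bound[OF ode V_0 even_V, of x] by (simp add: norm_mult norm_divide)
    show "cmod (of_real \<omega> * (1 / cnj (u x))) \<le> \<bar>\<omega>\<bar> * 1"
      using norm_inverse_u_le_1[of x] unfolding norm_mult
      by (intro mult_mono) (auto simp: norm_divide)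
  qed auto
  also have "\<dots> \<le> \<bar>x\<bar> * (1 / 2 + 12 * \<bar>\<omega>\<bar>)"
    by (intro mult_left_mono) auto
  finally show ?thesis
    by (simp add: mult.commute)
qed

lemma even_V_minus_1: "even_fun (\<lambda>x. V x - 1)"
  using even_V by (simp add: even_fun_def)

lemma has_vector_derivative_V_minus_1: "((\<lambda>x. V x - 1) has_vector_derivative V' x) (at x)"
  using has_vector_derivative_diff[OF ode has_vector_derivative_const[of 1]] by simp

text \<open>The solution map preserves admissibility: the new bounds depend on \<omega> alone, while
  R/4 exceeds 5 + 50 |\<omega>|.\<close>

lemma admissible_V: "admissible \<alpha> V"
proof
  fix x
  show "cmod (V x - 1) \<le> R / 4"
    using norm_V_minus_1[of x] large by simp
  have "cmod (V x - 1) \<le> (1 / 2 + 12 * \<bar>\<omega>\<bar>) / 2 * x\<^sup>2"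
    using norm_le_square_if_deriv_le_linear[OF has_vector_derivative_V_minus_1 _ even_V_minus_1 norm_V'] V_0
    by simp
  also have "\<dots> \<le> R / 8 * x\<^sup>2"
    using large by (intro mult_right_mono) auto
  finally show "cmod (V x - 1) \<le> R / 8 * x\<^sup>2" .
qed (use Re_gt_1 norm_alpha cont_V in auto)

text \<open>The equation itself yields C^1 regularity, its right-hand side being continuous. The two
  norms add up to at most 5/2 + 33 |\<omega>|, which is below R/4.\<close>

lemma V_in_one_plus_E_set: "V \<in> one_plus (E_set \<alpha>)"
proof -
  let ?w = "\<lambda>x. V x - 1"
  have w': "vector_derivative ?w (at x) = V' x" for x
    by (rule vector_derivative_at[OF has_vector_derivative_V_minus_1])
  have cont_V': "continuous_on UNIV V'"
    using u_nonzero by (intro continuous_intros cont_V cont_u) auto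
  have "?w C1_differentiable_on UNIV"
    unfolding C1_differentiable_on_def
    by (intro exI[of _ V'] conjI ballI has_vector_derivative_V_minus_1 cont_V')
  moreover have "Linf_norm ?w + Linf_norm (\<lambda>x. vector_derivative ?w (at x) /\<^sub>R \<bar>x\<bar>) \<le> ereal (R / 4)"
  proof -
    have "Linf_norm ?w \<le> ereal (2 + 21 * \<bar>\<omega>\<bar>)"
      by (intro Linf_norm_le norm_V_minus_1 borel_measurable_continuous_onI continuous_intros cont_V)
    moreover have "Linf_norm (\<lambda>x. V' x /\<^sub>R \<bar>x\<bar>) \<le> ereal (1 / 2 + 12 * \<bar>\<omega>\<bar>)"
    proof (rule Linf_norm_le)
      show "(\<lambda>x. V' x /\<^sub>R \<bar>x\<bar>) \<in> borel_measurable borel"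
        using borel_measurable_continuous_onI[OF cont_V'] by measurable
      have "cmod (V' x /\<^sub>R \<bar>x\<bar>) = cmod (V' x) / \<bar>x\<bar>" for x
        by (simp only: norm_scaleR divide_inverse abs_inverse abs_idempotent mult.commute)
      then show "cmod (V' x /\<^sub>R \<bar>x\<bar>) \<le> 1 / 2 + 12 * \<bar>\<omega>\<bar>" for x
        using norm_V'[of x] by (cases "x = 0") (auto simp only: divide_le_eq zero_less_abs_iff, auto)
    qed
    ultimately have "Linf_norm ?w + Linf_norm (\<lambda>x. V' x /\<^sub>R \<bar>x\<bar>)
        \<le> ereal (2 + 21 * \<bar>\<omega>\<bar>) + ereal (1 / 2 + 12 * \<bar>\<omega>\<bar>)"
      by (rule add_mono)
    also have "\<dots> \<le> ereal (R / 4)"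
      using large by simp
    finally show ?thesis
      unfolding w' .
  qed
  ultimately have "?w \<in> E_set \<alpha>"
    using V_0 even_V_minus_1 by (simp add: E_set_def w')
  then show ?thesis
    unfolding one_plus_def by (rule rev_image_eqI) simp
qed

end

section \<open>Solving the linear equation by Duhamel's formula\<close>

text \<open>The usual integral over z from 0 to x is rewritten with s = z^2, which turns \<omega> z
  dz into (\<omega>/2) ds. One formula then covers both signs of \<open>x\<close>, and evenness is
  visible.\<close>

definition duhamel :: "complex \<Rightarrow> real \<Rightarrow> (real \<Rightarrow> complex) \<Rightarrow> real \<Rightarrow> complex"
  where "duhamel \<alpha> \<omega> v x = phase (1 / 4) x * (1 + of_real (\<omega> / 2) *
    integral {0..x\<^sup>2} (\<lambda>s. exp (- (\<i> * of_real (s / 4))) * (1 / cnj (u_of \<alpha> v (sqrt s)))))"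

lemma (in admissible) has_vector_derivative_duhamel:
  "(duhamel \<alpha> \<omega> v has_vector_derivative
    (1 / 2 * \<i> * of_real x * duhamel \<alpha> \<omega> v x + of_real \<omega> * of_real x * (1 / cnj (u x)))) (at x)"
proof -
  define h where "h = (\<lambda>s. exp (- (\<i> * of_real (s / 4))) * (1 / cnj (u (sqrt s))))"
  define I where "I = (\<lambda>s. integral {0..s} h)"
  have "continuous_on A h" for A
    unfolding h_def
    using u_nonzero by (intro continuous_intros continuous_on_compose2[OF cont_u]) auto
  then have "(I has_vector_derivative h (x\<^sup>2)) (at (x\<^sup>2) within {0..x\<^sup>2 + 1})"
    unfolding I_def by (intro integral_has_vector_derivative) auto
  \<comment> \<open>At x = 0 the integral is differentiated from the right only. This suffices,
    because squaring takes values in the half-line and the chain rule is applied within its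
    range.\<close>
  also have "at (x\<^sup>2) within {0..x\<^sup>2 + 1} = at (x\<^sup>2) within {0..}"
    by (rule at_within_nhd[of _ "{..<x\<^sup>2 + 1}"]) auto
  finally have "(I has_vector_derivative h (x\<^sup>2)) (at (x\<^sup>2) within (\<lambda>x. x\<^sup>2) ` UNIV)"
    by (rule has_vector_derivative_within_subset) auto
  moreover have "((\<lambda>x. x\<^sup>2) has_vector_derivative 2 * x) (at x)"
    unfolding has_real_derivative_iff_has_vector_derivative[symmetric]
    by (auto intro!: derivative_eq_intros)
  ultimately have "((\<lambda>x. I (x\<^sup>2)) has_vector_derivative (2 * x) *\<^sub>R h (x\<^sup>2)) (at x)"
    using vector_diff_chain_within[of "\<lambda>x. x\<^sup>2" "2 * x" x UNIV I "h (x\<^sup>2)"] by (simp add: o_def)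
  then have "((\<lambda>x. 1 + of_real (\<omega> / 2) * I (x\<^sup>2)) has_vector_derivative
      0 + of_real (\<omega> / 2) * ((2 * x) *\<^sub>R h (x\<^sup>2))) (at x)"
    by (intro has_vector_derivative_add has_vector_derivative_const has_vector_derivative_mult_right)
  from has_vector_derivative_mult[OF has_vector_derivative_phase[of "1 / 4"] this]
  have "(duhamel \<alpha> \<omega> v has_vector_derivative
      phase (1 / 4) x * (0 + of_real (\<omega> / 2) * ((2 * x) *\<^sub>R h (x\<^sup>2)))
      + 2 * \<i> * of_real (1 / 4 * x) * phase (1 / 4) x * (1 + of_real (\<omega> / 2) * I (x\<^sup>2))) (at x)"
    by (simp add: duhamel_def[abs_def] h_def I_def)
  moreover have "phase (1 / 4) x * h (x\<^sup>2) = 1 / cnj (u x)"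
  proof -
    have "h (x\<^sup>2) = phase (- (1 / 4)) x * (1 / cnj (u x))"
      by (simp add: h_def phase_def u_abs)
    then show ?thesis
      using phase_minus_cancel[of "1 / 4" x] by (simp add: mult.assoc[symmetric] mult.commute)
  qed
  then have forcing: "phase (1 / 4) x * (of_real (\<omega> / 2) * ((2 * x) *\<^sub>R h (x\<^sup>2))) = of_real \<omega> * of_real x * (1 / cnj (u x))"
    by (simp add: scaleR_conv_of_real algebra_simps)
  moreover have duhamel: "phase (1 / 4) x * (1 + of_real (\<omega> / 2) * I (x\<^sup>2)) = duhamel \<alpha> \<omega> v x"
    by (simp add: duhamel_def h_def I_def)
  ultimately show ?thesis
    unfolding forcing[symmetric] duhamel[symmetric]
    by (elim has_vector_derivative_eq_rhs) (simp add: algebra_simps)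
qed

lemma (in admissible) solution_duhamel:
  assumes "20 + 200 * \<bar>\<omega>\<bar> < R"
  shows "solution \<alpha> v \<omega> (duhamel \<alpha> \<omega> v)"
proof
  show "20 + 200 * \<bar>\<omega>\<bar> < R" by fact
  show "duhamel \<alpha> \<omega> v 0 = 1" "even_fun (duhamel \<alpha> \<omega> v)"
    by (simp_all add: duhamel_def even_fun_def phase_def)
qed (rule has_vector_derivative_duhamel)

section \<open>Uniqueness and existence of the fixed point\<close>

text \<open>Viewed as bounded continuous functions, two fixed points have a finite uniform distance,
  and the contraction makes it at most half of itself.\<close>

lemma solution_unique:
  assumes "solution \<alpha> v1 \<omega> v1" and "solution \<alpha> v2 \<omega> v2"
  shows "v1 = v2"
proof -
  interpret v1: solution \<alpha> v1 \<omega> v1 by fact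
  interpret v2: solution \<alpha> v2 \<omega> v2 by fact
  obtain f1 f2 where f: "v1 = apply_bcontfun f1" "v2 = apply_bcontfun f2"
    using v1.v_in_bcontfun v2.v_in_bcontfun by (meson bcontfunE)
  have "cmod (v1 x - v2 x) \<le> dist f1 f2" for x
    using dist_bounded[of f1 x f2] by (simp add: f dist_norm)
  from solution_contraction[OF v1.admissible_axioms v2.admissible_axioms this v1.large v1.ode v2.ode _ v1.even_V v2.even_V]
  have "dist f1 f2 \<le> dist f1 f2 / 2"
    using v1.V_0 v2.V_0 by (intro dist_bound) (simp add: f dist_norm)
  then show ?thesis
    using zero_le_dist[of f1 f2] by (simp add: f)
qed

lemma solution_exists:
  assumes large: "20 + 200 * \<bar>\<omega>\<bar> < Re \<alpha>" and alpha: "cmod \<alpha> \<le> (Re \<alpha>)\<^sup>2"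
  shows "\<exists>v. solution \<alpha> v \<omega> v"
proof -
  \<comment> \<open>Both pointwise bounds merge into one ball with an \<open>x\<close>-dependent
    radius, so closedness of \<open>X\<close> in the uniform metric follows from that of the
    balls.\<close>
  define X :: "(real \<Rightarrow>\<^sub>C complex) set" where
    "X = PiC UNIV (\<lambda>x. cball 1 (min (Re \<alpha> / 4) (Re \<alpha> / 8 * x\<^sup>2)))"
  \<comment> \<open>\<open>Bcontfun\<close> is meaningful only on bounded continuous functions; for
    \<open>f\<close> in \<open>X\<close> the Duhamel solution is again admissible, hence one of
    these.\<close>
  define T where "T = (\<lambda>f :: real \<Rightarrow>\<^sub>C complex. Bcontfun (duhamel \<alpha> \<omega> f))"
  have X: "f \<in> X \<longleftrightarrow> admissible \<alpha> f" for f
    using large alpha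
    by (auto simp: X_def mem_PiC_iff Pi_iff admissible_def dist_norm norm_minus_commute)
  have sol: "solution \<alpha> f \<omega> (duhamel \<alpha> \<omega> f)" if "f \<in> X" for f
    using admissible.solution_duhamel large that X by blast
  have T: "apply_bcontfun (T f) = duhamel \<alpha> \<omega> f" if "f \<in> X" for f
    unfolding T_def
    by (rule Bcontfun_inverse[OF admissible.v_in_bcontfun[OF solution.admissible_V[OF sol[OF that]]]])
  have "\<exists>!f\<in>X. T f = f"
  proof (rule Banach_fix[of X "1 / 2"])
    show "complete X"
      unfolding X_def complete_eq_closed by (intro closed_PiC) auto
    have "const_bcontfun 1 \<in> X"
      using large by (auto simp: X_def mem_PiC_iff const_bcontfun.rep_eq)
    then show "X \<noteq> {}" by blast
    show "T ` X \<subseteq> X"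
      using solution.admissible_V[OF sol] by (auto simp: X T)
    fix f g assume fg: "f \<in> X" "g \<in> X"
    interpret f: solution \<alpha> f \<omega> "duhamel \<alpha> \<omega> f" using sol[OF fg(1)] .
    interpret g: solution \<alpha> g \<omega> "duhamel \<alpha> \<omega> g" using sol[OF fg(2)] .
    have "cmod (f x - g x) \<le> dist f g" for x
      using dist_bounded[of f x g] by (simp add: dist_norm)
    from solution_contraction[OF f.admissible_axioms g.admissible_axioms this large f.ode g.ode _ f.even_V g.even_V]
    show "dist (T f) (T g) \<le> 1 / 2 * dist f g"
      using f.V_0 g.V_0 by (intro dist_bound) (simp add: T fg dist_norm)
  qed auto
  then obtain f where "f \<in> X" "T f = f" by blast
  then show ?thesis
    using sol[of f] T[of f] by auto
qed

theorem theorem1p5: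
  fixes \<omega> :: real
  shows "\<exists>K::real. K > 1 \<and>
    (\<forall>\<alpha>::complex. Re \<alpha> > K \<and> cmod \<alpha> \<le> (Re \<alpha>)\<^sup>2 \<longrightarrow>
      (\<exists>!v. v \<in> one_plus (E_set \<alpha>)
          \<and> is_solution \<omega> (u_of \<alpha> v) v
          \<and> u_of \<alpha> v \<sim>[at_infinity] (\<lambda>x. \<alpha> * of_real \<bar>x\<bar>))
    \<and> (\<forall>v. v \<in> one_plus (E_set \<alpha>)
          \<and> is_solution \<omega> (u_of \<alpha> v) v
          \<and> u_of \<alpha> v \<sim>[at_infinity] (\<lambda>x. \<alpha> * of_real \<bar>x\<bar>) \<longrightarrow>
            (\<forall>x. 1 \<le> cmod (u_of \<alpha> v x))
          \<and> even_fun (u_of \<alpha> v)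
          \<and> (\<exists>L. L-lipschitz_on UNIV (u_of \<alpha> v))
          \<and> u_of \<alpha> v C1_differentiable_on (UNIV - {0})))"
proof (rule exI[of _ "20 + 200 * \<bar>\<omega>\<bar>"], intro conjI allI impI; (elim conjE)?)
  \<comment> \<open>The threshold exceeds each requirement on R: 196 |\<omega>| for the contraction,
    10 + 132 |\<omega>| for the norm of E, and 2 + 48 |\<omega>| for the quadratic bound.\<close>
  show "1 < 20 + 200 * \<bar>\<omega>\<bar>" by simp
  fix \<alpha> :: complex
  assume large: "20 + 200 * \<bar>\<omega>\<bar> < Re \<alpha>" and alpha: "cmod \<alpha> \<le> (Re \<alpha>)\<^sup>2"
  from large have "1 < Re \<alpha>" by linarith
  note E = one_plus_E_setD[OF _ this alpha]
  \<comment> \<open>The conditions on \<open>v\<close> are recast as a fixed point of the linear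
    solution map, to which the existence and uniqueness results apply.\<close>
  have solution_iff: "v \<in> one_plus (E_set \<alpha>) \<and> is_solution \<omega> (u_of \<alpha> v) v
      \<and> u_of \<alpha> v \<sim>[at_infinity] (\<lambda>x. \<alpha> * of_real \<bar>x\<bar>) \<longleftrightarrow> solution \<alpha> v \<omega> v" for v
  proof
    assume v: "v \<in> one_plus (E_set \<alpha>) \<and> is_solution \<omega> (u_of \<alpha> v) v
      \<and> u_of \<alpha> v \<sim>[at_infinity] (\<lambda>x. \<alpha> * of_real \<bar>x\<bar>)"
    then show "solution \<alpha> v \<omega> v"
      using E[of v] large admissible.is_solution_u_iff[of \<alpha> v \<omega>]
      by (auto simp: solution_def solution_axioms_def)
  next
    assume "solution \<alpha> v \<omega> v"
    then interpret solution \<alpha> v \<omega> v .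
    show "v \<in> one_plus (E_set \<alpha>) \<and> is_solution \<omega> (u_of \<alpha> v) v
      \<and> u_of \<alpha> v \<sim>[at_infinity] (\<lambda>x. \<alpha> * of_real \<bar>x\<bar>)"
      using V_in_one_plus_E_set is_solution_u_iff[OF even_V] ode asymp_equiv_u by blast
  qed
  show "\<exists>!v. v \<in> one_plus (E_set \<alpha>) \<and> is_solution \<omega> (u_of \<alpha> v) v
      \<and> u_of \<alpha> v \<sim>[at_infinity] (\<lambda>x. \<alpha> * of_real \<bar>x\<bar>)"
    unfolding solution_iff using solution_exists[OF large alpha] solution_unique by blast
  fix v assume v: "v \<in> one_plus (E_set \<alpha>)"
  interpret admissible \<alpha> v by (rule E[OF v])
  show "1 \<le> cmod (u_of \<alpha> v x)" for x by (rule norm_u_ge_1)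
  show "even_fun (u_of \<alpha> v)" by (simp add: even_fun_def even_u)
  show "\<exists>L. L-lipschitz_on UNIV (u_of \<alpha> v)" using lipschitz_u by blast
  show "u_of \<alpha> v C1_differentiable_on (UNIV - {0})" by (rule C1_u[OF E(2)[OF v]])
qed

end
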